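(* Let $\mathbf{A}$ and $\mathbf{M}$ be complex $n\times n$ matrices with $\mathbf{M}$ self-adjoint and positive definite, and let $\mathbf{F}$ be an $n\times n$ complex matrix with $\mathbf{F}^*\mathbf{F}=\mathbf{M}$. Let $\epsilon\ge 0$ and $z\in\mathbb{C}$. Then the following conditions are equivalent: (0) $z$ is in the $\epsilon$-pseudospectrum of $(\mathbf{F}^{-1})^*\mathbf{A}\mathbf{F}^{-1}$; (i) the smallest $(\mathbf{M}^{-1},\mathbf{M})$-singular value of $\mathbf{A}-z\mathbf{M}$ is at most $\epsilon$, i.e. $\epsilon\ge\min\mu(\mathbf{A}-z\mathbf{M},\mathbf{M}^{-1},\mathbf{M})$; (ii) there exists $\mathbf{u}\in\mathbb{C}^n$ such that $\mathbf{u}^*\mathbf{M}\mathbf{u}=1$ and $\mathbf{u}^*(\mathbf{A}-z\mathbf{M})^*\mathbf{M}^{-1}(\mathbf{A}-z\mathbf{M})\mathbf{u}\le\epsilon^2$; (iii) $z\in\Lambda(\mathbf{A},\mathbf{M})$, or $z\in\rho(\mathbf{A},\mathbf{M})$ and there exists $\mathbf{w}\in\mathbb{C}^n$ such that $\mathbf{w}^*\mathbf{M}^{-1}\mathbf{w}=1$ and $\mathbf{w}^*\big((\mathbf{A}-z\mathbf{M})^{-1}\big)^*\mathbf{M}(\mathbf{A}-z\mathbf{M})^{-1}\mathbf{w}\ge 1/\epsilon^2$; (iv) there exists an $n\times n$ complex matrix $\mathbf{E}$ with $\|\mathbf{E}\|\le 1$ such that $z\in\Lambda(\mathbf{A}+\epsilon\mathbf{F}^*\mathbf{E}\mathbf{F},\mathbf{M})$;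 (iv') there exists an $n\times n$ complex matrix $\mathbf{H}$ with $$\max_{0\ne\mathbf{u}\in\mathbb{C}^n}\frac{\mathbf{u}^*\mathbf{H}^*\mathbf{M}^{-1}\mathbf{H}\mathbf{u}}{\mathbf{u}^*\mathbf{M}\mathbf{u}}\le 1$$ such that $z\in\Lambda(\mathbf{A}+\epsilon\mathbf{H},\mathbf{M})$; (v) there exist $\mathbf{u}_1,\mathbf{u}_2\in\mathbb{C}^n$ with $\mathbf{u}_1^*\mathbf{M}\mathbf{u}_1\le 1$ and $\mathbf{u}_2^*\mathbf{M}\mathbf{u}_2\le 1$ such that, with $\mathbf{w}_1=\mathbf{M}\mathbf{u}_1$ and $\mathbf{w}_2=\mathbf{M}\mathbf{u}_2$, one has $z\in\Lambda(\mathbf{A}+\epsilon\mathbf{w}_2\mathbf{w}_1^*,\mathbf{M})$; (vi) there exists $\mathbf{u}\in\mathbb{C}^n$ with $\mathbf{u}^*\mathbf{M}\mathbf{u}\le 1$ and $\mathbf{u}^*(\mathbf{A}-z\mathbf{M})^*\mathbf{M}^{-1}(\mathbf{A}-z\mathbf{M})\mathbf{u}\le\epsilon^2$ such that, with $\mathbf{w}=\mathbf{M}\mathbf{u}$, one has $z\in\Lambda(\mathbf{A}-(\mathbf{A}\mathbf{u}-z\mathbf{M}\mathbf{u})\mathbf{w}^*,\mathbf{M})$.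
   Context: $\|\cdot\|$ is the Euclidean 2-norm on $\mathbb{C}^n$ and the induced operator norm on matrices; $^*$ denotes conjugate transpose. For $n\times n$ matrices $\mathbf{B}$ and $\mathbf{M}$, the generalized spectrum $\Lambda(\mathbf{B},\mathbf{M})$ is the set of $\lambda\in\mathbb{C}$ such that $\mathbf{B}\mathbf{e}=\lambda\mathbf{M}\mathbf{e}$ for some nonzero $\mathbf{e}\in\mathbb{C}^n$, and $\rho(\mathbf{B},\mathbf{M})=\mathbb{C}\setminus\Lambda(\mathbf{B},\mathbf{M})$ is the resolvent set. The $\epsilon$-pseudospectrum of an $n\times n$ matrix $\mathbf{B}$ is the set of $z\in\mathbb{C}$ such that the smallest singular value of $\mathbf{B}-z\mathbf{I}$ is at most $\epsilon$. For positive definite $n\times n$ matrices $\mathbf{S},\mathbf{T}$ and an $n\times n$ matrix $\mathbf{B}$, the set of $(\mathbf{S},\mathbf{T})$-singular values of $\mathbf{B}$ is $$\mu(\mathbf{B},\mathbf{S},\mathbf{T})=\Big\{\mu\ge 0:\ \mu^2\text{ is a stationary value of }\mathbf{x}\mapsto\frac{\mathbf{x}^*\mathbf{B}^*\mathbf{S}\mathbf{B}\mathbf{x}}{\mathbf{x}^*\mathbf{T}\mathbf{x}}\text{ on }\mathbb{C}^n\setminus\{0\}\Big\}.$$ When $\epsilon=0$, $1/\epsilon^2$ is read as $+\infty$. *)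

theory Defs
  imports "HOL-Analysis.Analysis"
begin

definition conj_transpose :: "complex^'n^'m \<Rightarrow> complex^'m^'n"  (\<open>(_\<^sup>H)\<close> [1000] 999)
  where "B\<^sup>H = (\<chi> i j. cnj (B $ j $ i))"

definition cscale :: "complex \<Rightarrow> complex^'n^'m \<Rightarrow> complex^'n^'m"  (infixr \<open>*\<^sub>C\<close> 75)
  where "z *\<^sub>C B = (\<chi> i j. z * B $ i $ j)"

text \<open>\<open>outer x y\<close> is the rank-one matrix \<open>x y\<^sup>*\<close>.\<close>

definition outer :: "complex^'m \<Rightarrow> complex^'n \<Rightarrow> complex^'n^'m"
  where "outer x y = (\<chi> i j. x $ i * cnj (y $ j))"

text \<open>The form \<open>x\<^sup>* Q x\<close>. It is only used for self-adjoint \<open>Q\<close>, where it is real, so that taking the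
  real part merely changes the type.\<close>

definition quad :: "complex^'n^'n \<Rightarrow> complex^'n \<Rightarrow> real"
  where "quad Q x = Re (\<Sum>i\<in>UNIV. cnj (x $ i) * (Q *v x) $ i)"

definition positive_definite :: "complex^'n^'n \<Rightarrow> bool"
  where "positive_definite Q \<longleftrightarrow> Q\<^sup>H = Q \<and> (\<forall>x. x \<noteq> 0 \<longrightarrow> 0 < quad Q x)"

definition gen_spectrum :: "complex^'n^'n \<Rightarrow> complex^'n^'n \<Rightarrow> complex set"
  where "gen_spectrum B M = {l. \<exists>e. e \<noteq> 0 \<and> B *v e = l *s (M *v e)}"

definition resolvent_set :: "complex^'n^'n \<Rightarrow> complex^'n^'n \<Rightarrow> complex set"
  where "resolvent_set B M = - gen_spectrum B M"

definition singular_values :: "complex^'n^'n \<Rightarrow> real set"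
  where "singular_values B =
    {s. 0 \<le> s \<and> (\<exists>x. x \<noteq> 0 \<and> (B\<^sup>H ** B) *v x = complex_of_real (s\<^sup>2) *s x)}"

text \<open>\<open>singular_values B\<close> is finite and nonempty (the eigenvalues of \<open>B\<^sup>* B\<close> are nonnegative), so
  \<open>Min\<close> is its least element.\<close>

definition pseudospectrum :: "real \<Rightarrow> complex^'n^'n \<Rightarrow> complex set"
  where "pseudospectrum \<epsilon> B = {z. Min (singular_values (B - z *\<^sub>C mat 1)) \<le> \<epsilon>}"

text \<open>Stationarity is with respect to the real Frechet derivative: a nonconstant real-valued function
  on \<open>\<complex>\<^sup>n\<close> has no complex derivative in general. The domain \<open>S\<close> is meant to be open.\<close>

definition stationary_value :: "('a::real_normed_vector \<Rightarrow> real) \<Rightarrow> 'a set \<Rightarrow> real \<Rightarrow> bool"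
  where "stationary_value f S v \<longleftrightarrow> (\<exists>x\<in>S. (f has_derivative (\<lambda>h. 0)) (at x) \<and> f x = v)"

text \<open>For positive definite \<open>S\<close> and \<open>T\<close> the set below is finite and nonempty, the squares of its
  elements being the eigenvalues of the pencil \<open>(B\<^sup>* S B, T)\<close>; again \<open>Min\<close> is its least element.\<close>

definition gen_singular_values ::
    "complex^'n^'n \<Rightarrow> complex^'n^'n \<Rightarrow> complex^'n^'n \<Rightarrow> real set"
  where "gen_singular_values B S T =
    {\<mu>. 0 \<le> \<mu> \<and> stationary_value (\<lambda>x. quad (B\<^sup>H ** S ** B) x / quad T x) (- {0}) (\<mu>\<^sup>2)}"

text \<open>Division in \<^typ>\<open>ereal\<close>, unlike division in \<^typ>\<open>real\<close>, follows the convention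
  \<open>1 / \<epsilon>\<^sup>2 = \<infinity>\<close> for \<open>\<epsilon> = 0\<close>.\<close>

lemma ereal_inverse_square_conv:
  "1 / ereal (\<epsilon>\<^sup>2) = (if \<epsilon> = 0 then \<infinity> else ereal (1 / \<epsilon>\<^sup>2))"
  by (simp add: divide_ereal_def one_ereal_def inverse_eq_divide)

end

theory Submission
  imports Defs
begin

text \<open>
  The substitution \<open>f = F u\<close> turns every condition into a condition on the single matrix
  \<open>B = (F\<^sup>-\<^sup>1)\<^sup>* (A - z M) F\<^sup>-\<^sup>1 = (F\<^sup>-\<^sup>1)\<^sup>* A F\<^sup>-\<^sup>1 - z I\<close> and the Euclidean norm: \<open>F\<close> carries the norm
  \<open>u \<mapsto> (u\<^sup>* M u)\<^sup>1\<^sup>/\<^sup>2\<close> to the Euclidean one, \<open>(F\<^sup>-\<^sup>1)\<^sup>*\<close> does the same for the norm given by \<open>M\<^sup>-\<^sup>1\<close>, and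
  \<open>A - z M = F\<^sup>* B F\<close>. All conditions are then compared with
  \<open>\<exists>f \<noteq> 0. \<parallel>B f\<parallel> \<le> \<epsilon> \<parallel>f\<parallel>\<close>.

  The least singular value \<open>s\<close> of \<open>B\<close> is the minimum of \<open>\<parallel>B f\<parallel>\<close> over the unit sphere. The minimum is
  attained by compactness, and its minimiser is a stationary point of the Rayleigh quotient, hence
  an eigenvector of \<open>B\<^sup>* B\<close> (\<open>least_singular_value_attained\<close>, \<open>Min_singular_values_le_iff\<close>).
  The stationary values of a quotient of two Hermitian forms are the eigenvalues of the corresponding
  pencil (\<open>stationary_value_quad_quotient_iff\<close>), and the substitution identifies those with the
  eigenvalues of \<open>B\<^sup>* B\<close>; therefore the weighted singular values of \<open>A - z M\<close> are exactly the
  singular values of \<open>B\<close> (\<open>gen_singular_values_eq\<close>).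

  For the perturbations, each matrix added to \<open>A\<close> has the form \<open>F\<^sup>* E F\<close>, and \<open>z\<close> is an eigenvalue of the
  perturbed pencil exactly when \<open>B f = - E f\<close> for some \<open>f \<noteq> 0\<close> (\<open>gen_spectrum_perturbed_iff\<close>). If
  \<open>\<parallel>E\<parallel> \<le> \<epsilon>\<close> this gives \<open>\<parallel>B f\<parallel> \<le> \<epsilon> \<parallel>f\<parallel>\<close>. Conversely, a unit vector \<open>v\<close> with
  \<open>\<parallel>B v\<parallel> \<le> \<epsilon>\<close> is annihilated by \<open>B - (B v) v\<^sup>*\<close>, so a perturbation of rank one and norm at most
  \<open>\<epsilon>\<close> always suffices (\<open>rank_one_perturbation\<close>).
\<close>

section \<open>The Hermitian product and the adjoint\<close>

definition hdot :: "complex^'n \<Rightarrow> complex^'n \<Rightarrow> complex"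
  where "hdot x y = (\<Sum>i\<in>UNIV. cnj (x $ i) * y $ i)"

lemma Re_hdot: "Re (hdot x y) = x \<bullet> y"
  by (simp add: hdot_def inner_vec_def inner_complex_def)

lemma hdot_self: "hdot x x = of_real ((norm x)\<^sup>2)"
proof (rule complex_eqI)
  show "Re (hdot x x) = Re (of_real ((norm x)\<^sup>2))"
    by (simp add: Re_hdot dot_square_norm)
  show "Im (hdot x x) = Im (of_real ((norm x)\<^sup>2))"
    by (simp add: hdot_def algebra_simps)
qed

lemma hdot_scale_right: "hdot x (c *s y) = c * hdot x y"
  by (simp add: hdot_def sum_distrib_left mult_ac)

lemma norm_scale: "norm (c *s x) = cmod c * norm x" for x :: "complex^'n"
  by (simp add: norm_vec_def norm_mult L2_set_right_distrib)

lemma of_real_scale: "complex_of_real r *s x = r *\<^sub>R x"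
  by (simp add: vec_eq_iff vector_scalar_mult_def scaleR_conv_of_real[where 'a=complex])

text \<open>The complex Cauchy--Schwarz inequality follows from the real one: multiplying \<open>y\<close> by a suitable
  phase makes the product real and nonnegative without changing any norm.\<close>

lemma norm_hdot_le: "cmod (hdot x y) \<le> norm x * norm y"
proof (cases "hdot x y = 0")
  case False
  define c where "c = cnj (sgn (hdot x y))"
  have c: "cmod c = 1"
    using False by (simp add: c_def norm_sgn)
  have "c * hdot x y = hdot x y * cnj (hdot x y) / of_real (cmod (hdot x y))"
    by (simp add: c_def sgn_eq)
  also have "\<dots> = of_real (cmod (hdot x y))"
    using False by (simp add: power2_eq_square flip: complex_norm_square)
  finally have "c * hdot x y = of_real (cmod (hdot x y))" .
  then have "cmod (hdot x y) = x \<bullet> (c *s y)"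
    by (metis Re_complex_of_real Re_hdot hdot_scale_right)
  also have "\<dots> \<le> norm x * norm (c *s y)"
    by (rule norm_cauchy_schwarz)
  finally show ?thesis
    by (simp add: norm_scale c)
qed simp

lemma hdot_conj_transpose: "hdot (X\<^sup>H *v x) y = hdot x (X *v y)"
proof -
  have "hdot (X\<^sup>H *v x) y = (\<Sum>i\<in>UNIV. \<Sum>j\<in>UNIV. X $ j $ i * cnj (x $ j) * y $ i)"
    by (simp add: hdot_def conj_transpose_def matrix_vector_mult_def sum_distrib_right)
  also have "\<dots> = (\<Sum>j\<in>UNIV. \<Sum>i\<in>UNIV. X $ j $ i * cnj (x $ j) * y $ i)"
    by (rule sum.swap)
  also have "\<dots> = hdot x (X *v y)"
    by (simp add: hdot_def matrix_vector_mult_def sum_distrib_left mult_ac)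
  finally show ?thesis .
qed

lemma inner_conj_transpose: "(X\<^sup>H *v x) \<bullet> y = x \<bullet> (X *v y)"
  by (metis Re_hdot hdot_conj_transpose)

lemma conj_transpose_mult: "(X ** Y)\<^sup>H = Y\<^sup>H ** X\<^sup>H"
  by (simp add: conj_transpose_def matrix_matrix_mult_def vec_eq_iff mult.commute)

lemma conj_transpose_conj_transpose [simp]: "(X\<^sup>H)\<^sup>H = X"
  by (simp add: conj_transpose_def vec_eq_iff)

lemma conj_transpose_mat_1 [simp]: "(mat 1)\<^sup>H = mat 1"
  by (simp add: conj_transpose_def mat_def vec_eq_iff)

lemma quad_eq_inner: "quad Q x = x \<bullet> (Q *v x)"
  unfolding quad_def hdot_def[symmetric] Re_hdot ..

lemma quad_conj_transpose_mult: "quad (X\<^sup>H ** X) x = (norm (X *v x))\<^sup>2"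
  by (metis quad_eq_inner inner_conj_transpose inner_commute matrix_vector_mul_assoc
      dot_square_norm)

lemma outer_vector_mult: "outer x y *v e = hdot y e *s x"
  by (simp add: outer_def hdot_def matrix_vector_mult_def vec_eq_iff sum_distrib_left
      mult_ac)

lemma mult_outer_mult: "X ** outer x y ** Y\<^sup>H = outer (X *v x) (Y *v y)"
proof -
  have "(X ** outer x y ** Y\<^sup>H) *v e = outer (X *v x) (Y *v y) *v e" for e
    by (simp add: outer_vector_mult vector_scalar_commute
        hdot_conj_transpose[of "Y\<^sup>H", simplified] flip: matrix_vector_mul_assoc)
  then show ?thesis
    by (simp add: matrix_eq)
qed

lemma norm_outer_vector_mult_le: "norm (outer x y *v e) \<le> norm x * norm y * norm e"
  using mult_right_mono[OF norm_hdot_le[of y e] norm_ge_zero[of x]]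
  by (simp add: outer_vector_mult norm_scale mult_ac)

lemma matrix_vector_scaleR: "X *v (r *\<^sub>R x) = r *\<^sub>R (X *v x)" for X :: "complex^'n^'m"
  by (rule linear_scale[OF matrix_vector_mul_linear])

lemma scaleR_matrix_vector: "(r *\<^sub>R X) *v x = r *\<^sub>R (X *v x)" for X :: "complex^'n^'m"
  by (simp add: matrix_vector_mult_def vec_eq_iff scaleR_sum_right)

lemma cscale_matrix_vector: "(c *\<^sub>C X) *v x = c *s (X *v x)"
  by (simp add: cscale_def matrix_vector_mult_def vec_eq_iff sum_distrib_left mult_ac)

lemma matrix_inv_mult:
  assumes "invertible X"
  shows "X ** matrix_inv X = mat 1" and "matrix_inv X ** X = mat 1"
  using someI_ex[OF assms[unfolded invertible_def]] by (simp_all add: matrix_inv_def)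

lemma matrix_inv_unique:
  fixes X Y :: "'a::semiring_1^'n^'n"
  assumes "X ** Y = mat 1" and "Y ** X = mat 1"
  shows "matrix_inv X = Y"
proof -
  have "invertible X"
    using assms unfolding invertible_def by blast
  then show ?thesis
    by (metis assms(1) matrix_inv_mult(2) matrix_mul_assoc matrix_mul_lid matrix_mul_rid)
qed

lemma invertible_if_trivial_kernel:
  fixes X :: "'a::field^'n^'n"
  assumes "\<And>x. X *v x = 0 \<Longrightarrow> x = 0"
  shows "invertible X"
proof -
  have "inj ((*v) X)"
    by (rule injI) (metis assms eq_iff_diff_eq_0 matrix_vector_mult_diff_distrib)
  then show ?thesis
    by (simp add: invertible_left_inverse matrix_left_invertible_injective)
qed

section \<open>Stationary values of a quotient of quadratic forms\<close>

lemma has_derivative_quad: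
  assumes "K\<^sup>H = K"
  shows "(quad K has_derivative (\<lambda>h. 2 * ((K *v x) \<bullet> h))) (at x)"
proof -
  have "((\<lambda>y. y \<bullet> (K *v y)) has_derivative (\<lambda>h. x \<bullet> (K *v h) + h \<bullet> (K *v x))) (at x)"
    by (intro derivative_intros bounded_linear.has_derivative[OF matrix_vector_mul_bounded_linear])
  moreover have "x \<bullet> (K *v h) + h \<bullet> (K *v x) = 2 * ((K *v x) \<bullet> h)" for h
    using inner_conj_transpose[of K x h] by (simp add: assms inner_commute)
  moreover have "quad K = (\<lambda>y. y \<bullet> (K *v y))"
    by (simp add: fun_eq_iff quad_eq_inner)
  ultimately show ?thesis
    by simp
qed

text \<open>The gradient of the quotient at \<open>x\<close> is a positive multiple of \<open>K x - r T x\<close>, where \<open>r\<close> is the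
  value of the quotient at \<open>x\<close>.\<close>

lemma quad_quotient_derivative_zero_iff:
  assumes "K\<^sup>H = K" and "positive_definite T" and "x \<noteq> 0"
  shows "((\<lambda>y. quad K y / quad T y) has_derivative (\<lambda>h. 0)) (at x) \<longleftrightarrow>
    K *v x = (quad K x / quad T x) *\<^sub>R (T *v x)"
proof -
  have T: "T\<^sup>H = T" "quad T x > 0"
    using assms unfolding positive_definite_def by auto
  define g where "g = K *v x - (quad K x / quad T x) *\<^sub>R (T *v x)"
  have d: "((\<lambda>y. quad K y / quad T y) has_derivative (\<lambda>h. 2 / quad T x * (g \<bullet> h))) (at x)"
    using T assms(1)
    by (auto intro!: derivative_eq_intros has_derivative_quad
        simp: g_def inner_diff_left field_simps power2_eq_square)
  have "((\<lambda>y. quad K y / quad T y) has_derivative (\<lambda>h. 0)) (at x) \<longleftrightarrow> g = 0"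
  proof
    assume "((\<lambda>y. quad K y / quad T y) has_derivative (\<lambda>h. 0)) (at x)"
    from has_derivative_unique[OF d this] have "2 / quad T x * (g \<bullet> g) = 0"
      by metis
    then show "g = 0"
      using T(2) by simp
  next
    assume "g = 0"
    then show "((\<lambda>y. quad K y / quad T y) has_derivative (\<lambda>h. 0)) (at x)"
      using d by simp
  qed
  then show ?thesis
    by (simp add: g_def)
qed

lemma stationary_value_quad_quotient_iff:
  assumes "K\<^sup>H = K" and "positive_definite T"
  shows "stationary_value (\<lambda>x. quad K x / quad T x) (- {0}) v \<longleftrightarrow>
    (\<exists>x. x \<noteq> 0 \<and> K *v x = v *\<^sub>R (T *v x))"
proof -
  have "quad K x / quad T x = v" if "x \<noteq> 0" "K *v x = v *\<^sub>R (T *v x)" for x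
  proof -
    have "quad T x > 0"
      using assms that unfolding positive_definite_def by auto
    then show ?thesis
      by (simp add: quad_eq_inner that)
  qed
  then show ?thesis
    by (auto simp: stationary_value_def quad_quotient_derivative_zero_iff[OF assms])
qed

section \<open>Singular values\<close>

lemma singular_values_alt:
  "singular_values B = {s. 0 \<le> s \<and> (\<exists>x. x \<noteq> 0 \<and> (B\<^sup>H ** B) *v x = s\<^sup>2 *\<^sub>R x)}"
  by (simp only: singular_values_def of_real_scale)

text \<open>Eigenvectors of \<open>B\<^sup>* B\<close> for distinct eigenvalues are orthogonal already for the real inner
  product, hence linearly independent over the reals, and there are only finitely many of them.\<close>

lemma finite_singular_values: "finite (singular_values B)"
proof -
  define K where "K = B\<^sup>H ** B"
  have K: "K\<^sup>H = K"
    by (simp add: K_def conj_transpose_mult)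
  have "\<forall>s\<in>singular_values B. \<exists>x. x \<noteq> 0 \<and> K *v x = s\<^sup>2 *\<^sub>R x"
    by (auto simp: singular_values_alt K_def)
  then obtain x where x: "\<And>s. s \<in> singular_values B \<Longrightarrow> x s \<noteq> 0 \<and> K *v x s = s\<^sup>2 *\<^sub>R x s"
    by metis
  have orth: "x s \<bullet> x t = 0"
    if "s \<in> singular_values B" "t \<in> singular_values B" "s \<noteq> t" for s t
  proof -
    have "s\<^sup>2 * (x s \<bullet> x t) = t\<^sup>2 * (x s \<bullet> x t)"
      using inner_conj_transpose[of K "x s" "x t"] x that by (simp add: K)
    moreover have "s\<^sup>2 \<noteq> t\<^sup>2"
      using that by (auto simp: singular_values_alt)
    ultimately show ?thesis
      by auto
  qed
  have "inj_on x (singular_values B)"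
    by (rule inj_onI) (metis orth x inner_eq_zero_iff)
  moreover have "pairwise orthogonal (x ` singular_values B)"
    unfolding pairwise_def orthogonal_def using orth by auto
  then have "independent (x ` singular_values B)"
    by (rule pairwise_orthogonal_independent) (use x in auto)
  then have "finite (x ` singular_values B)"
    by (rule independent_imp_finite)
  ultimately show ?thesis
    by (rule finite_imageD[rotated])
qed

text \<open>A vector minimising \<open>\<parallel>B v\<parallel>\<close> on the unit sphere minimises the Rayleigh quotient of \<open>B\<^sup>* B\<close> on all
  nonzero vectors, so the derivative of the quotient vanishes there. This also shows that
  singular values exist at all.\<close>

lemma least_singular_value_attained:
  fixes B :: "complex^'n^'n"
  obtains s v where "s \<in> singular_values B" and "norm v = 1" and "norm (B *v v) = s"
    and "\<And>x. s * norm x \<le> norm (B *v x)"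
proof -
  have "sphere (0::complex^'n) 1 \<noteq> {}"
    using vector_choose_size[of 1] by auto
  moreover have "continuous_on (sphere 0 1) (\<lambda>x. norm (B *v x))"
    by (intro continuous_intros bounded_linear.continuous_on[OF matrix_vector_mul_bounded_linear])
  ultimately obtain v where v: "norm v = 1"
    and min: "\<And>x. norm x = 1 \<Longrightarrow> norm (B *v v) \<le> norm (B *v x)"
    using continuous_attains_inf[of "sphere (0::complex^'n) 1" "\<lambda>x. norm (B *v x)"] by auto
  define s where "s = norm (B *v v)"
  have le: "s * norm x \<le> norm (B *v x)" for x
  proof (cases "x = 0")
    case False
    then have "norm (B *v v) \<le> norm (B *v ((1 / norm x) *\<^sub>R x))"
      by (intro min) simp
    then show ?thesis
      using False by (simp add: s_def matrix_vector_scaleR field_simps)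
  qed simp
  let ?f = "\<lambda>y. quad (B\<^sup>H ** B) y / quad (mat 1) y"
  have f: "?f y = (norm (B *v y))\<^sup>2 / (norm y)\<^sup>2" for y
    by (simp add: quad_conj_transpose_mult quad_eq_inner[of "mat 1"] dot_square_norm)
  have pd: "positive_definite (mat 1 :: complex^'n^'n)"
    by (auto simp: positive_definite_def quad_eq_inner)
  have herm: "(B\<^sup>H ** B)\<^sup>H = B\<^sup>H ** B"
    by (simp add: conj_transpose_mult)
  have "?f v \<le> ?f y" if "y \<noteq> 0" for y
    using power_mono[OF le, of y 2] v that by (simp add: f s_def field_simps power_mult_distrib)
  then have "\<forall>\<^sub>F y in at v. ?f v \<le> ?f y"
    using v by (intro eventually_mono[OF eventually_neq_at_within[of 0]]) auto
  moreover have "quad (mat 1) v \<noteq> 0"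
    using v by (auto simp: quad_eq_inner)
  from has_derivative_divide[OF has_derivative_quad[OF herm] has_derivative_quad[OF conj_transpose_mat_1] this]
  obtain f' where f': "(?f has_derivative f') (at v)"
    by blast
  ultimately have "(?f has_derivative (\<lambda>h. 0)) (at v)"
    using has_derivative_local_min[OF f'] by simp
  then have "(B\<^sup>H ** B) *v v = s\<^sup>2 *\<^sub>R v"
    using quad_quotient_derivative_zero_iff[OF herm pd, of v] v f[of v]
    by (force simp: s_def)
  then have "s \<in> singular_values B"
    unfolding singular_values_alt using v by (auto simp: s_def intro!: exI[of _ v])
  then show ?thesis
    using v le by (intro that[of s v]) (simp_all add: s_def)
qed

lemma Min_singular_values_le_iff:
  assumes "0 \<le> \<epsilon>"
  shows "Min (singular_values B) \<le> \<epsilon> \<longleftrightarrow> (\<exists>f. f \<noteq> 0 \<and> norm (B *v f) \<le> \<epsilon> * norm f)"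
proof -
  obtain s v where s: "s \<in> singular_values B" "norm v = 1" "norm (B *v v) = s"
    and le: "\<And>x. s * norm x \<le> norm (B *v x)"
    using least_singular_value_attained[of B] by blast
  have "s \<le> t" if t: "t \<in> singular_values B" for t
  proof -
    obtain x where x: "x \<noteq> 0" "(B\<^sup>H ** B) *v x = t\<^sup>2 *\<^sub>R x" and "0 \<le> t"
      using t by (auto simp: singular_values_alt)
    have "(norm (B *v x))\<^sup>2 = (t * norm x)\<^sup>2"
      using quad_conj_transpose_mult[of B x] x
      by (simp add: quad_eq_inner dot_square_norm power_mult_distrib)
    then have "norm (B *v x) = t * norm x"
      using \<open>0 \<le> t\<close> by (simp add: power2_eq_iff_nonneg)
    then show ?thesis
      using le[of x] x by simp
  qed
  then have Min: "Min (singular_values B) = s"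
    using s(1) finite_singular_values by (intro Min_eqI) auto
  show ?thesis
  proof
    assume "Min (singular_values B) \<le> \<epsilon>"
    then show "\<exists>f. f \<noteq> 0 \<and> norm (B *v f) \<le> \<epsilon> * norm f"
      using s Min by (intro exI[of _ v]) auto
  next
    assume "\<exists>f. f \<noteq> 0 \<and> norm (B *v f) \<le> \<epsilon> * norm f"
    then obtain f where f: "f \<noteq> 0" "norm (B *v f) \<le> \<epsilon> * norm f"
      by blast
    then have "s * norm f \<le> \<epsilon> * norm f"
      using le[of f] by linarith
    then show "Min (singular_values B) \<le> \<epsilon>"
      using f(1) Min by simp
  qed
qed

lemma unit_vector_if_norm_le:
  fixes B :: "complex^'n^'m"
  assumes "f \<noteq> 0" and "norm (B *v f) \<le> \<epsilon> * norm f"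
  obtains v where "norm v = 1" and "norm (B *v v) \<le> \<epsilon>"
proof
  show "norm ((1 / norm f) *\<^sub>R f) = 1"
    using assms by simp
  show "norm (B *v ((1 / norm f) *\<^sub>R f)) \<le> \<epsilon>"
    using assms by (simp add: matrix_vector_scaleR field_simps)
qed

section \<open>Reduction of the pencil to a single matrix\<close>

locale factored_pencil =
  fixes A M F :: "complex^'n^'n" and z :: complex
  assumes positive_definite_M: "positive_definite M"
    and factorization: "F\<^sup>H ** F = M"
begin

definition G :: "complex^'n^'n" where "G = matrix_inv F"

text \<open>The matrix of \<open>A - z M\<close> in the coordinates \<open>F u\<close>, see \<open>pencil_vec\<close> below.\<close>

definition B :: "complex^'n^'n" where "B = G\<^sup>H ** A ** G - z *\<^sub>C mat 1"

lemma F_G [simp]: "F ** G = mat 1" and G_F [simp]: "G ** F = mat 1"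
proof -
  have "invertible F"
  proof (rule invertible_if_trivial_kernel)
    fix x
    assume "F *v x = 0"
    then have "quad M x = 0"
      using quad_conj_transpose_mult[of F x] factorization by simp
    then show "x = 0"
      using positive_definite_M unfolding positive_definite_def by force
  qed
  then show "F ** G = mat 1" "G ** F = mat 1"
    by (simp_all add: G_def matrix_inv_mult)
qed

lemma F_G_adjoint [simp]: "F\<^sup>H ** G\<^sup>H = mat 1" "G\<^sup>H ** F\<^sup>H = mat 1"
  by (simp_all flip: conj_transpose_mult)

lemma F_G_vec [simp]: "F *v (G *v x) = x" "G *v (F *v x) = x"
  "F\<^sup>H *v (G\<^sup>H *v x) = x" "G\<^sup>H *v (F\<^sup>H *v x) = x"
  by (simp_all add: matrix_vector_mul_assoc)

lemma F_eq_0_iff [simp]: "F *v x = 0 \<longleftrightarrow> x = 0"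
  by (metis F_G_vec(2) matrix_vector_mult_0_right)

lemma M_vec: "M *v x = F\<^sup>H *v (F *v x)"
  by (simp add: matrix_vector_mul_assoc factorization)

lemma quad_M: "quad M u = (norm (F *v u))\<^sup>2"
  using quad_conj_transpose_mult[of F u] factorization by simp

lemma matrix_inv_M: "matrix_inv M = G ** G\<^sup>H"
proof (rule matrix_inv_unique)
  have "M ** (G ** G\<^sup>H) = F\<^sup>H ** (F ** G) ** G\<^sup>H"
    by (simp only: matrix_mul_assoc factorization[symmetric])
  then show "M ** (G ** G\<^sup>H) = mat 1"
    by simp
  have "G ** G\<^sup>H ** M = G ** (G\<^sup>H ** F\<^sup>H) ** F"
    by (simp only: matrix_mul_assoc factorization[symmetric])
  then show "G ** G\<^sup>H ** M = mat 1"
    by simp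
qed

lemma quad_congruence_matrix_inv_M:
  "quad (X\<^sup>H ** matrix_inv M ** X) u = (norm (G\<^sup>H *v (X *v u)))\<^sup>2"
  using quad_conj_transpose_mult[of "G\<^sup>H ** X" u]
  by (simp add: conj_transpose_mult matrix_inv_M matrix_mul_assoc matrix_vector_mul_assoc)

lemma quad_congruence_M: "quad (X\<^sup>H ** M ** X) u = (norm (F *v (X *v u)))\<^sup>2"
  using quad_conj_transpose_mult[of "F ** X" u]
  by (simp add: conj_transpose_mult matrix_mul_assoc matrix_vector_mul_assoc
      flip: factorization)

lemma pencil_vec: "(A - z *\<^sub>C M) *v u = F\<^sup>H *v (B *v (F *v u))"
  by (simp add: B_def matrix_vector_mult_diff_rdistrib matrix_vector_mult_diff_distrib
      cscale_matrix_vector vector_scalar_commute M_vec flip: matrix_vector_mul_assoc)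

lemma quad_residual:
  "quad ((A - z *\<^sub>C M)\<^sup>H ** matrix_inv M ** (A - z *\<^sub>C M)) u = (norm (B *v (F *v u)))\<^sup>2"
  by (simp add: quad_congruence_matrix_inv_M pencil_vec)

lemma pseudospectrum_iff:
  assumes "0 \<le> \<epsilon>"
  shows "z \<in> pseudospectrum \<epsilon> ((matrix_inv F)\<^sup>H ** A ** matrix_inv F) \<longleftrightarrow>
    (\<exists>f. f \<noteq> 0 \<and> norm (B *v f) \<le> \<epsilon> * norm f)"
  using Min_singular_values_le_iff[OF assms, of B]
  by (simp add: pseudospectrum_def B_def G_def)

text \<open>Since \<open>A - z M = F\<^sup>* B F\<close> and \<open>M\<^sup>-\<^sup>1 = F\<^sup>-\<^sup>1 (F\<^sup>-\<^sup>1)\<^sup>*\<close>, the numerator of the quotient has the matrix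
  \<open>F\<^sup>* (B\<^sup>* B) F\<close> and the denominator \<open>F\<^sup>* F\<close>; the eigenvalues of this pencil are those of \<open>B\<^sup>* B\<close>.\<close>

lemma gen_singular_values_eq:
  "gen_singular_values (A - z *\<^sub>C M) (matrix_inv M) M = singular_values B"
proof -
  let ?K = "(A - z *\<^sub>C M)\<^sup>H ** matrix_inv M ** (A - z *\<^sub>C M)"
  have N: "A - z *\<^sub>C M = F\<^sup>H ** B ** F"
    by (simp add: matrix_eq pencil_vec flip: matrix_vector_mul_assoc)
  have K: "?K = F\<^sup>H ** (B\<^sup>H ** B) ** F"
    unfolding N by (simp add: matrix_eq conj_transpose_mult matrix_inv_M flip: matrix_vector_mul_assoc)
  then have herm: "?K\<^sup>H = ?K"
    by (simp add: conj_transpose_mult matrix_mul_assoc)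
  have eq: "?K *v x = r *\<^sub>R (M *v x) \<longleftrightarrow> (B\<^sup>H ** B) *v (F *v x) = r *\<^sub>R (F *v x)" for x r
  proof -
    have "?K *v x = F\<^sup>H *v ((B\<^sup>H ** B) *v (F *v x))"
      by (simp add: K flip: matrix_vector_mul_assoc)
    moreover have "r *\<^sub>R (M *v x) = F\<^sup>H *v (r *\<^sub>R (F *v x))"
      by (simp add: M_vec matrix_vector_scaleR)
    ultimately show ?thesis
      by (metis F_G_vec(4))
  qed
  have "(\<exists>x. x \<noteq> 0 \<and> ?K *v x = r *\<^sub>R (M *v x)) \<longleftrightarrow>
      (\<exists>y. y \<noteq> 0 \<and> (B\<^sup>H ** B) *v y = r *\<^sub>R y)" for r
    unfolding eq by (metis F_G_vec(1) F_eq_0_iff)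
  then show ?thesis
    by (simp only: gen_singular_values_def singular_values_alt
        stationary_value_quad_quotient_iff[OF herm positive_definite_M])
qed

section \<open>Perturbations of the pencil\<close>

lemma gen_spectrum_perturbed_iff:
  "z \<in> gen_spectrum (A + F\<^sup>H ** E ** F) M \<longleftrightarrow> (\<exists>f. f \<noteq> 0 \<and> B *v f + E *v f = 0)"
proof -
  have "(A + F\<^sup>H ** E ** F) *v e = z *s (M *v e) \<longleftrightarrow> B *v (F *v e) + E *v (F *v e) = 0" for e
  proof -
    have "(A + F\<^sup>H ** E ** F) *v e - z *s (M *v e)
        = (A - z *\<^sub>C M) *v e + F\<^sup>H *v (E *v (F *v e))"
      by (simp add: algebra_simps cscale_matrix_vector flip: matrix_vector_mul_assoc)
    also have "\<dots> = F\<^sup>H *v (B *v (F *v e) + E *v (F *v e))"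
      by (simp add: pencil_vec matrix_vector_right_distrib)
    finally show ?thesis
      by (metis F_G_vec(4) eq_iff_diff_eq_0 matrix_vector_mult_0_right)
  qed
  then show ?thesis
    unfolding gen_spectrum_def mem_Collect_eq by (metis F_G_vec(1) F_eq_0_iff)
qed

lemma gen_spectrum_iff: "z \<in> gen_spectrum A M \<longleftrightarrow> (\<exists>f. f \<noteq> 0 \<and> B *v f = 0)"
  using gen_spectrum_perturbed_iff[of 0] by simp

lemma outer_scaleR_left: "r *\<^sub>R outer x y = outer (r *\<^sub>R x) y"
  by (simp add: outer_def vec_eq_iff)

lemma outer_M: "outer (M *v x) (M *v y) = F\<^sup>H ** outer (F *v x) (F *v y) ** F"
  using mult_outer_mult[of "F\<^sup>H" "F *v x" "F *v y" "F\<^sup>H"] by (simp add: M_vec)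

lemma scaleR_congruence: "r *\<^sub>R (F\<^sup>H ** E ** F) = F\<^sup>H ** (r *\<^sub>R E) ** F"
  by (simp add: matrix_eq scaleR_matrix_vector matrix_vector_scaleR flip: matrix_vector_mul_assoc)

lemma near_kernel_if_perturbation:
  assumes "z \<in> gen_spectrum (A + F\<^sup>H ** E ** F) M" and "\<And>f. norm (E *v f) \<le> \<epsilon> * norm f"
  shows "\<exists>f. f \<noteq> 0 \<and> norm (B *v f) \<le> \<epsilon> * norm f"
proof -
  obtain f where "f \<noteq> 0" "B *v f + E *v f = 0"
    using assms(1) gen_spectrum_perturbed_iff by blast
  then show ?thesis
    using assms(2)[of f] by (metis add_eq_0_iff norm_minus_cancel)
qed

text \<open>The vector \<open>v\<close> itself lies in the kernel of \<open>B - (B v) v\<^sup>*\<close>.\<close>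

lemma rank_one_perturbation:
  assumes "norm v = 1"
  shows "z \<in> gen_spectrum (A + F\<^sup>H ** outer (- (B *v v)) v ** F) M"
  unfolding gen_spectrum_perturbed_iff
  using assms by (intro exI[of _ v]) (auto simp: outer_vector_mult hdot_self)

lemma scaled_rank_one_perturbation:
  assumes "f \<noteq> 0" and "norm (B *v f) \<le> \<epsilon> * norm f" and "0 \<le> \<epsilon>"
  obtains v1 v2 where "norm v1 = 1" and "norm v2 \<le> 1"
    and "z \<in> gen_spectrum (A + F\<^sup>H ** (\<epsilon> *\<^sub>R outer v2 v1) ** F) M"
proof -
  obtain v where v: "norm v = 1" "norm (B *v v) \<le> \<epsilon>"
    using unit_vector_if_norm_le[OF assms(1,2)] .
  \<comment> \<open>For \<open>\<epsilon> = 0\<close> division by zero makes \<open>v2\<close> zero, which is the right choice because then \<open>B v = 0\<close>.\<close>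
  define v2 where "v2 = (- 1 / \<epsilon>) *\<^sub>R (B *v v)"
  have "\<epsilon> *\<^sub>R v2 = - (B *v v)"
    using v assms(3) by (cases "\<epsilon> = 0") (simp_all add: v2_def)
  then have "\<epsilon> *\<^sub>R outer v2 v = outer (- (B *v v)) v"
    by (simp add: outer_scaleR_left)
  moreover have "norm v2 \<le> 1"
    using v assms(3) by (cases "\<epsilon> = 0") (simp_all add: v2_def field_simps)
  ultimately show ?thesis
    using that[of v v2] v rank_one_perturbation[OF v(1)] by simp
qed

section \<open>The criteria\<close>

lemma singular_value_criterion:
  assumes "0 \<le> \<epsilon>"
  shows "(\<exists>f. f \<noteq> 0 \<and> norm (B *v f) \<le> \<epsilon> * norm f) \<longleftrightarrow>
    Min (gen_singular_values (A - z *\<^sub>C M) (matrix_inv M) M) \<le> \<epsilon>"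
  using Min_singular_values_le_iff[OF assms, of B] by (simp add: gen_singular_values_eq)

lemma residual_criterion:
  assumes "0 \<le> \<epsilon>"
  shows "(\<exists>f. f \<noteq> 0 \<and> norm (B *v f) \<le> \<epsilon> * norm f) \<longleftrightarrow>
    (\<exists>u. quad M u = 1 \<and>
       quad ((A - z *\<^sub>C M)\<^sup>H ** matrix_inv M ** (A - z *\<^sub>C M)) u \<le> \<epsilon>\<^sup>2)"
    (is "?L \<longleftrightarrow> ?R")
proof
  assume ?L
  then obtain v where v: "norm v = 1" "norm (B *v v) \<le> \<epsilon>"
    using unit_vector_if_norm_le by metis
  then show ?R
    unfolding quad_residual quad_M by (intro exI[of _ "G *v v"]) (auto intro: power_mono)
next
  assume ?R
  then obtain u where "norm (F *v u) = 1" "norm (B *v (F *v u)) \<le> \<epsilon>"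
    using assms unfolding quad_residual quad_M by (auto simp: abs_square_eq_1)
  then show ?L
    by (intro exI[of _ "F *v u"]) auto
qed

text \<open>Off the spectrum, \<open>w \<mapsto> f = F (A - z M)\<^sup>-\<^sup>1 w\<close> is a bijection under which the two forms in \<open>w\<close> become
  \<open>\<parallel>B f\<parallel>\<^sup>2\<close> and \<open>\<parallel>f\<parallel>\<^sup>2\<close>, so that only a normalisation of \<open>f\<close> remains. For \<open>\<epsilon> = 0\<close> both sides are false.\<close>

lemma resolvent_criterion:
  assumes "0 \<le> \<epsilon>"
  shows "(\<exists>f. f \<noteq> 0 \<and> norm (B *v f) \<le> \<epsilon> * norm f) \<longleftrightarrow>
    z \<in> gen_spectrum A M \<or>
    (z \<in> resolvent_set A M \<and>
     (\<exists>w. quad (matrix_inv M) w = 1 \<and>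
        ereal (quad ((matrix_inv (A - z *\<^sub>C M))\<^sup>H ** M ** matrix_inv (A - z *\<^sub>C M)) w)
          \<ge> 1 / ereal (\<epsilon>\<^sup>2)))"
proof (cases "z \<in> gen_spectrum A M")
  case True
  then show ?thesis
    using assms by (auto simp: gen_spectrum_iff)
next
  case False
  define N where "N = A - z *\<^sub>C M"
  have B_nz: "B *v f \<noteq> 0" if "f \<noteq> 0" for f
    using False that by (auto simp: gen_spectrum_iff)
  have N_vec: "N *v u = F\<^sup>H *v (B *v (F *v u))" for u
    by (simp add: N_def pencil_vec)
  have "invertible N"
  proof (rule invertible_if_trivial_kernel)
    fix x assume "N *v x = 0"
    then show "x = 0"
      by (metis B_nz F_G_vec(4) F_eq_0_iff N_vec matrix_vector_mult_0_right)
  qed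
  then have inv: "N *v (matrix_inv N *v w) = w" "matrix_inv N *v (N *v w) = w" for w
    by (simp_all add: matrix_vector_mul_assoc matrix_inv_mult)
  have lhs: "quad (matrix_inv M) w = (norm (B *v (F *v (matrix_inv N *v w))))\<^sup>2" for w
  proof -
    have "G\<^sup>H *v w = G\<^sup>H *v (N *v (matrix_inv N *v w))"
      by (simp only: inv)
    also have "\<dots> = B *v (F *v (matrix_inv N *v w))"
      by (simp add: N_vec)
    finally show ?thesis
      using quad_congruence_matrix_inv_M[of "mat 1" w] by simp
  qed
  have ge: "1 / ereal (\<epsilon>\<^sup>2) \<le> ereal (r\<^sup>2) \<longleftrightarrow> 1 \<le> \<epsilon> * r" if "0 \<le> r" for r
  proof (cases "\<epsilon> = 0")
    case False
    have "1 / \<epsilon>\<^sup>2 \<le> r\<^sup>2 \<longleftrightarrow> 1\<^sup>2 \<le> (\<epsilon> * r)\<^sup>2"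
      using False by (simp add: field_simps)
    also have "\<dots> \<longleftrightarrow> 1 \<le> \<epsilon> * r"
      using assms that by (intro power_mono_iff) auto
    finally show ?thesis
      using False by (simp add: ereal_inverse_square_conv)
  next
    case True
    then have inf: "1 / ereal (\<epsilon>\<^sup>2) = \<infinity>"
      using ereal_inverse_square_conv[of \<epsilon>] by metis
    show ?thesis
      unfolding inf using True by simp
  qed
  have "(\<exists>f. f \<noteq> 0 \<and> norm (B *v f) \<le> \<epsilon> * norm f) \<longleftrightarrow>
      (\<exists>f. norm (B *v f) = 1 \<and> 1 \<le> \<epsilon> * norm f)"
  proof
    assume "\<exists>f. f \<noteq> 0 \<and> norm (B *v f) \<le> \<epsilon> * norm f"
    then obtain f where f: "f \<noteq> 0" "norm (B *v f) \<le> \<epsilon> * norm f"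
      by blast
    then show "\<exists>f. norm (B *v f) = 1 \<and> 1 \<le> \<epsilon> * norm f"
      using B_nz[of f]
      by (intro exI[of _ "(1 / norm (B *v f)) *\<^sub>R f"]) (auto simp: matrix_vector_scaleR field_simps)
  next
    assume "\<exists>f. norm (B *v f) = 1 \<and> 1 \<le> \<epsilon> * norm f"
    then show "\<exists>f. f \<noteq> 0 \<and> norm (B *v f) \<le> \<epsilon> * norm f"
      by (metis matrix_vector_mult_0_right norm_zero zero_neq_one)
  qed
  also have "\<dots> \<longleftrightarrow> (\<exists>w. norm (B *v (F *v (matrix_inv N *v w))) = 1 \<and>
      1 \<le> \<epsilon> * norm (F *v (matrix_inv N *v w)))"
    by (metis F_G_vec(1) inv(2))
  also have "\<dots> \<longleftrightarrow> (\<exists>w. quad (matrix_inv M) w = 1 \<and>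
      ereal (quad ((matrix_inv N)\<^sup>H ** M ** matrix_inv N) w) \<ge> 1 / ereal (\<epsilon>\<^sup>2))"
    by (simp add: lhs quad_congruence_M ge abs_square_eq_1)
  finally show ?thesis
    using False by (simp add: N_def resolvent_set_def)
qed

lemma perturbation_criterion:
  assumes "0 \<le> \<epsilon>"
  shows "(\<exists>f. f \<noteq> 0 \<and> norm (B *v f) \<le> \<epsilon> * norm f) \<longleftrightarrow>
    (\<exists>E :: complex^'n^'n. onorm ((*v) E) \<le> 1 \<and>
       z \<in> gen_spectrum (A + \<epsilon> *\<^sub>R (F\<^sup>H ** E ** F)) M)" (is "?L \<longleftrightarrow> ?R")
proof
  assume ?L
  then obtain v1 v2 where v: "norm v1 = 1" "norm v2 \<le> 1"
    and z: "z \<in> gen_spectrum (A + F\<^sup>H ** (\<epsilon> *\<^sub>R outer v2 v1) ** F) M"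
    using scaled_rank_one_perturbation assms by metis
  have "norm (outer v2 v1 *v e) \<le> 1 * norm e" for e
    using norm_outer_vector_mult_le[of v2 v1 e] mult_right_mono[OF v(2) norm_ge_zero[of e]] v(1)
    by simp
  then have "onorm ((*v) (outer v2 v1)) \<le> 1"
    by (rule onorm_le)
  then show ?R
    using z by (auto simp: scaleR_congruence)
next
  assume ?R
  then obtain E :: "complex^'n^'n" where E: "onorm ((*v) E) \<le> 1"
    and z: "z \<in> gen_spectrum (A + F\<^sup>H ** (\<epsilon> *\<^sub>R E) ** F) M"
    by (auto simp: scaleR_congruence)
  have "norm ((\<epsilon> *\<^sub>R E) *v f) \<le> \<epsilon> * norm f" for f
  proof -
    have "norm (E *v f) \<le> onorm ((*v) E) * norm f"
      by (rule onorm) simp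
    also have "\<dots> \<le> norm f"
      using mult_right_mono[OF E norm_ge_zero[of f]] by simp
    finally show ?thesis
      using assms by (simp add: scaleR_matrix_vector mult_left_mono)
  qed
  then show ?L
    by (rule near_kernel_if_perturbation[OF z])
qed

text \<open>The quotient at \<open>u\<close> is \<open>(\<parallel>E f\<parallel> / \<parallel>f\<parallel>)\<^sup>2\<close> for \<open>f = F u\<close>. A real supremum bounds the values only
  if they are bounded above, and here the operator norm of \<open>E\<close> provides the bound.\<close>

lemma SUP_quotient_le_1_iff:
  "(SUP u\<in>- {0}. quad ((F\<^sup>H ** E ** F)\<^sup>H ** matrix_inv M ** (F\<^sup>H ** E ** F)) u / quad M u) \<le> 1
    \<longleftrightarrow> onorm ((*v) E) \<le> 1"
proof -
  let ?q = "\<lambda>u. quad ((F\<^sup>H ** E ** F)\<^sup>H ** matrix_inv M ** (F\<^sup>H ** E ** F)) u / quad M u"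
  have q: "?q u = (norm (E *v (F *v u)) / norm (F *v u))\<^sup>2" for u
    by (simp add: quad_congruence_matrix_inv_M quad_M power_divide flip: matrix_vector_mul_assoc)
  have le: "norm (E *v f) / norm f \<le> onorm ((*v) E)" for f
    by (rule le_onorm) simp
  have bdd: "bdd_above (?q ` (- {0}))"
    unfolding q by (rule bdd_aboveI2[of _ _ "(onorm ((*v) E))\<^sup>2"]) (intro power_mono le, simp)
  have ne: "- {0} \<noteq> ({} :: (complex^'n) set)"
    using vector_choose_size[of 1, where 'a = "complex^'n"] by auto
  have "(SUP u\<in>- {0}. ?q u) \<le> 1 \<longleftrightarrow> (\<forall>u\<in>- {0}. ?q u \<le> 1)"
    by (rule cSUP_le_iff[OF ne bdd])
  also have "\<dots> \<longleftrightarrow> (\<forall>u\<in>- {0}. norm (E *v (F *v u)) \<le> norm (F *v u))"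
    unfolding q by (simp add: power_le_one_iff divide_le_eq)
  also have "\<dots> \<longleftrightarrow> (\<forall>f. norm (E *v f) \<le> norm f)"
    by (metis ComplI F_G_vec(1) matrix_vector_mult_0_right norm_zero order_refl singletonD)
  also have "\<dots> \<longleftrightarrow> onorm ((*v) E) \<le> 1"
  proof
    assume "\<forall>f. norm (E *v f) \<le> norm f"
    then show "onorm ((*v) E) \<le> 1"
      by (intro onorm_le) simp
  next
    assume "onorm ((*v) E) \<le> 1"
    then show "\<forall>f. norm (E *v f) \<le> norm f"
      using onorm[OF matrix_vector_mul_bounded_linear, of E] mult_right_mono[OF _ norm_ge_zero]
      by (metis (no_types) mult_1 order_trans)
  qed
  finally show ?thesis .
qed

text \<open>Every matrix \<open>H\<close> has the form \<open>F\<^sup>* E F\<close>, and \<open>SUP_quotient_le_1_iff\<close> translates the constraint on \<open>H\<close>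
  into \<open>\<parallel>E\<parallel> \<le> 1\<close>.\<close>

lemma weighted_perturbation_criterion:
  assumes "0 \<le> \<epsilon>"
  shows "(\<exists>f. f \<noteq> 0 \<and> norm (B *v f) \<le> \<epsilon> * norm f) \<longleftrightarrow>
    (\<exists>H :: complex^'n^'n.
       (SUP u\<in>- {0}. quad (H\<^sup>H ** matrix_inv M ** H) u / quad M u) \<le> 1 \<and>
       z \<in> gen_spectrum (A + \<epsilon> *\<^sub>R H) M)"
proof -
  let ?P = "\<lambda>H. (SUP u\<in>- {0}. quad (H\<^sup>H ** matrix_inv M ** H) u / quad M u) \<le> 1 \<and>
    z \<in> gen_spectrum (A + \<epsilon> *\<^sub>R H) M"
  have H: "F\<^sup>H ** (G\<^sup>H ** H ** G) ** F = H" for H :: "complex^'n^'n"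
    by (simp add: matrix_eq flip: matrix_vector_mul_assoc)
  have "?P H \<Longrightarrow> \<exists>E. ?P (F\<^sup>H ** E ** F)" for H
    by (rule exI[of _ "G\<^sup>H ** H ** G"]) (simp only: H)
  then have "(\<exists>H. ?P H) \<longleftrightarrow> (\<exists>E. ?P (F\<^sup>H ** E ** F))"
    by blast
  then show ?thesis
    unfolding perturbation_criterion[OF assms] by (simp only: SUP_quotient_le_1_iff)
qed

lemma rank_one_perturbation_criterion:
  assumes "0 \<le> \<epsilon>"
  shows "(\<exists>f. f \<noteq> 0 \<and> norm (B *v f) \<le> \<epsilon> * norm f) \<longleftrightarrow>
    (\<exists>u1 u2. quad M u1 \<le> 1 \<and> quad M u2 \<le> 1 \<and>
       z \<in> gen_spectrum (A + \<epsilon> *\<^sub>R outer (M *v u2) (M *v u1)) M)" (is "?L \<longleftrightarrow> ?R")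
proof
  assume ?L
  then obtain v1 v2 where "norm v1 = 1" "norm v2 \<le> 1"
    and "z \<in> gen_spectrum (A + F\<^sup>H ** (\<epsilon> *\<^sub>R outer v2 v1) ** F) M"
    using scaled_rank_one_perturbation assms by metis
  then show ?R
    by (intro exI[of _ "G *v v1"] exI[of _ "G *v v2"])
      (simp add: outer_M scaleR_congruence quad_M power_le_one)
next
  assume ?R
  then obtain u1 u2 where u: "norm (F *v u1) \<le> 1" "norm (F *v u2) \<le> 1"
    and z: "z \<in> gen_spectrum (A + F\<^sup>H ** (\<epsilon> *\<^sub>R outer (F *v u2) (F *v u1)) ** F) M"
    by (auto simp: outer_M scaleR_congruence quad_M power_le_one_iff)
  have "norm ((\<epsilon> *\<^sub>R outer (F *v u2) (F *v u1)) *v f) \<le> \<epsilon> * norm f" for f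
  proof -
    have "norm (outer (F *v u2) (F *v u1) *v f) \<le> norm (F *v u2) * norm (F *v u1) * norm f"
      by (rule norm_outer_vector_mult_le)
    also have "\<dots> \<le> 1 * norm f"
      using u by (intro mult_right_mono mult_le_one) auto
    finally show ?thesis
      using assms by (simp add: scaleR_matrix_vector mult_left_mono)
  qed
  then show ?L
    by (rule near_kernel_if_perturbation[OF z])
qed

text \<open>The subtracted matrix is \<open>F\<^sup>* (B v) v\<^sup>* F\<close> with \<open>v = F u\<close>, whose middle factor \<open>(B v) v\<^sup>*\<close> has norm
  \<open>\<parallel>B v\<parallel> \<parallel>v\<parallel> \<le> \<epsilon>\<close>.\<close>

lemma residual_perturbation_criterion:
  assumes "0 \<le> \<epsilon>"
  shows "(\<exists>f. f \<noteq> 0 \<and> norm (B *v f) \<le> \<epsilon> * norm f) \<longleftrightarrow>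
    (\<exists>u. quad M u \<le> 1 \<and>
       quad ((A - z *\<^sub>C M)\<^sup>H ** matrix_inv M ** (A - z *\<^sub>C M)) u \<le> \<epsilon>\<^sup>2 \<and>
       z \<in> gen_spectrum (A - outer (A *v u - z *s (M *v u)) (M *v u)) M)" (is "?L \<longleftrightarrow> ?R")
proof -
  have outer: "A - outer (A *v u - z *s (M *v u)) (M *v u)
      = A + F\<^sup>H ** outer (- (B *v (F *v u))) (F *v u) ** F" for u
  proof -
    have "A *v u - z *s (M *v u) = F\<^sup>H *v (B *v (F *v u))"
      by (simp add: matrix_vector_mult_diff_rdistrib cscale_matrix_vector flip: pencil_vec)
    then have "outer (A *v u - z *s (M *v u)) (M *v u)
        = F\<^sup>H ** outer (B *v (F *v u)) (F *v u) ** F"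
      using mult_outer_mult[of "F\<^sup>H" _ _ "F\<^sup>H"] by (simp add: M_vec)
    moreover have "F\<^sup>H ** outer (- x) y ** F = - (F\<^sup>H ** outer x y ** F)" for x y
      using mult_outer_mult[of "F\<^sup>H" _ y "F\<^sup>H"]
      by (simp add: linear_neg[OF matrix_vector_mul_linear]) (simp add: outer_def vec_eq_iff)
    ultimately show ?thesis
      by simp
  qed
  show ?thesis
  proof
    assume ?L
    then obtain v where v: "norm v = 1" "norm (B *v v) \<le> \<epsilon>"
      using unit_vector_if_norm_le by metis
    then show ?R
      using rank_one_perturbation[OF v(1)] unfolding quad_residual quad_M outer
      by (intro exI[of _ "G *v v"]) (auto intro: power_mono)
  next
    assume ?R
    then obtain u where u: "norm (F *v u) \<le> 1" "norm (B *v (F *v u)) \<le> \<epsilon>"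
      and z: "z \<in> gen_spectrum (A + F\<^sup>H ** outer (- (B *v (F *v u))) (F *v u) ** F) M"
      using assms unfolding quad_residual quad_M outer
      by (auto simp: power_mono_iff power_le_one_iff)
    have "norm (outer (- (B *v (F *v u))) (F *v u) *v f) \<le> \<epsilon> * norm f" for f
    proof -
      have "norm (outer (- (B *v (F *v u))) (F *v u) *v f)
          \<le> norm (B *v (F *v u)) * norm (F *v u) * norm f"
        using norm_outer_vector_mult_le[of "- (B *v (F *v u))"] by simp
      also have "\<dots> \<le> \<epsilon> * 1 * norm f"
        using u assms by (intro mult_right_mono mult_mono) auto
      finally show ?thesis
        by simp
    qed
    then show ?L
      by (rule near_kernel_if_perturbation[OF z])
  qed
qed

end

section \<open>Equivalent descriptions of the weighted pseudospectrum\<close>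

theorem mainTheorem2:
  fixes A M F :: "complex^'n^'n" and \<epsilon> :: real and z :: complex
  assumes "positive_definite M"
    and "F\<^sup>H ** F = M"
    and "0 \<le> \<epsilon>"
  defines "P0 \<equiv> z \<in> pseudospectrum \<epsilon> ((matrix_inv F)\<^sup>H ** A ** matrix_inv F)"
  shows
    "(P0 \<longleftrightarrow> Min (gen_singular_values (A - z *\<^sub>C M) (matrix_inv M) M) \<le> \<epsilon>) \<and>
     (P0 \<longleftrightarrow> (\<exists>u. quad M u = 1 \<and>
        quad ((A - z *\<^sub>C M)\<^sup>H ** matrix_inv M ** (A - z *\<^sub>C M)) u \<le> \<epsilon>\<^sup>2)) \<and>
     (P0 \<longleftrightarrow> z \<in> gen_spectrum A M \<or>
        (z \<in> resolvent_set A M \<and>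
         (\<exists>w. quad (matrix_inv M) w = 1 \<and>
            ereal (quad ((matrix_inv (A - z *\<^sub>C M))\<^sup>H ** M ** matrix_inv (A - z *\<^sub>C M)) w)
              \<ge> 1 / ereal (\<epsilon>\<^sup>2)))) \<and>
     (P0 \<longleftrightarrow> (\<exists>E :: complex^'n^'n. onorm ((*v) E) \<le> 1 \<and>
        z \<in> gen_spectrum (A + \<epsilon> *\<^sub>R (F\<^sup>H ** E ** F)) M)) \<and>
     (P0 \<longleftrightarrow> (\<exists>H :: complex^'n^'n.
        (SUP u\<in>- {0}. quad (H\<^sup>H ** matrix_inv M ** H) u / quad M u) \<le> 1 \<and>
        z \<in> gen_spectrum (A + \<epsilon> *\<^sub>R H) M)) \<and>
     (P0 \<longleftrightarrow> (\<exists>u1 u2. quad M u1 \<le> 1 \<and> quad M u2 \<le> 1 \<and>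
        (let w1 = M *v u1; w2 = M *v u2 in
         z \<in> gen_spectrum (A + \<epsilon> *\<^sub>R outer w2 w1) M))) \<and>
     (P0 \<longleftrightarrow> (\<exists>u. quad M u \<le> 1 \<and>
        quad ((A - z *\<^sub>C M)\<^sup>H ** matrix_inv M ** (A - z *\<^sub>C M)) u \<le> \<epsilon>\<^sup>2 \<and>
        (let w = M *v u in
         z \<in> gen_spectrum (A - outer (A *v u - z *s (M *v u)) w) M)))"
proof -
  interpret factored_pencil A M F z
    using assms(1,2) by unfold_locales
  note P0_iff = pseudospectrum_iff[OF assms(3)]
  show ?thesis
    unfolding P0_def P0_iff Let_def
    by (intro conjI singular_value_criterion residual_criterion resolvent_criterion
        perturbation_criterion weighted_perturbation_criterion
        rank_one_perturbation_criterion residual_perturbation_criterion assms(3))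
qed

end
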